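(* Let $\{T^{(n)}\}_{n\in\mathbb{N}}$ be a sequence of $n\times n$ matrices with real eigenvalues having spectral symbol $\omega$, i.e. $\{T^{(n)}\}_n\sim_\lambda\omega$, where $\omega:D\subset\mathbb{R}^m\to\mathbb{R}$ belongs to $L^1(D,\mu_m)$, and let $\tilde\omega:[0,1]\to[\min R_\omega,\max R_\omega]$ be the (strictly increasing) monotone rearrangement of $\omega$. Let $\tilde\omega$ be piecewise Lipschitz continuous. Then $$ \lim_{n\to\infty}\frac{\left|\left\{k=1,\ldots,n:\lambda_k(T^{(n)})\le t\right\}\right|}{n}=\tilde\omega^{-1}(t)\qquad\text{for } t\in[\min R_\omega,\max R_\omega]. $$ In particular, let $k=k(n)$ be such that $k(n)/n\to x$ as $n\to\infty$ for a fixed $x\in[0,1]$, and $\lambda_{k(n)}(T^{(n)})\in\tilde\omega([0,1])=R_\omega$ for all sufficiently large $n$. Then, as $n\to\infty$, $$ \lambda_{k(n)}(T^{(n)})-\tilde\omega\left(\frac{k(n)}{n}\right)\to0 \qquad\text{and}\qquad \left(\frac{k(n)}{n},\lambda_{k(n)}(T^{(n)})\right)\to(x,\tilde\omega(x)). $$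
   Context: Eigenvalues are always listed in non-decreasing order $\lambda_1\le\dots\le\lambda_n$. Spectral symbol: for a measurable $\omega:D\subset\mathbb{R}^m\to\mathbb{C}$ with $0<\mu_m(D)<\infty$ ($\mu_m$ Lebesgue measure), $\{T^{(n)}\}_n\sim_\lambda\omega$ means that for all $F\in C_c(\mathbb{C})$, $$\lim_{n\to\infty}\frac1n\sum_{k=1}^nF(\lambda_k(T^{(n)}))=\frac1{\mu_m(D)}\int_DF(\omega(\mathbf{x}))\,d\mu_m(\mathbf{x}).$$ Essential range: $R_\omega=\{t:\mu_m(\{\mathbf{x}\in D:|\omega(\mathbf{x})-t|<\epsilon\})>0\ \forall\epsilon>0\}$. Monotone rearrangement of a real-valued $\omega$: with $\phi(t)=\frac{1}{\mu_m(D)}\mu_m\{\mathbf{x}\in D:\omega(\mathbf{x})\le t\}$, set $\tilde\omega(x)=\inf\{t\in[\inf R_\omega,\sup R_\omega]:\phi(t)\ge x\}$ for $x\in[0,1]$. The paper takes $\tilde\omega$ to be strictly increasing, and $\tilde\omega^{-1}$ denotes its inverse, extended to be constant on the gaps of the range of $\tilde\omega$, so that $\tilde\omega^{-1}=\phi$ on $[\min R_\omega,\max R_\omega]$.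
   Formalization: In the "in particular" part, the equality ω̃([0,1]) = R_ω is not asserted but assumed, or alternatively ω̃ is assumed continuous at x, since the claim fails at jump points of ω̃; eigenvalue membership is only required in R_ω. *)

theory Defs
  imports "HOL-Analysis.Analysis" "Jordan_Normal_Form.Char_Poly"
begin

definition eigvals_mset :: "complex mat \<Rightarrow> complex multiset" where
  "eigvals_mset A = proots (char_poly A)"

text \<open>
  The \<open>k\<close>-th eigenvalue, \<open>1 \<le> k \<le> n\<close>, in non-decreasing order and counted with algebraic
  multiplicity. Only meant for matrices all of whose eigenvalues are real, where \<^const>\<open>Re\<close>
  merely changes the type.
\<close>

definition eigval :: "complex mat \<Rightarrow> nat \<Rightarrow> real" where
  "eigval A k = sorted_list_of_multiset (image_mset Re (eigvals_mset A)) ! (k - 1)"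

definition Cc :: "(complex \<Rightarrow> complex) set" where
  "Cc = {F. continuous_on UNIV F \<and> compact (closure {z. F z \<noteq> 0})}"

text \<open>
  The sum over all eigenvalues does not depend on their order, so it is taken over the multiset.
  This makes sense for arbitrary complex eigenvalues.
\<close>

definition has_spectral_symbol ::
  "(nat \<Rightarrow> complex mat) \<Rightarrow> (real ^ 'm) set \<Rightarrow> (real ^ 'm \<Rightarrow> complex) \<Rightarrow> bool" where
  "has_spectral_symbol T D \<omega> \<longleftrightarrow>
     (\<forall>F \<in> Cc. (\<lambda>n. (\<Sum>z\<in>#eigvals_mset (T n). F z) / of_nat n)
        \<longlonglongrightarrow> (\<integral>x. F (\<omega> x) \<partial>lebesgue_on D) / of_real (measure lebesgue D))"

definition ess_range :: "(real ^ 'm) set \<Rightarrow> (real ^ 'm \<Rightarrow> real) \<Rightarrow> real set" where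
  "ess_range D \<omega> = {t. \<forall>\<epsilon>>0. measure lebesgue {x \<in> D. \<bar>\<omega> x - t\<bar> < \<epsilon>} > 0}"

definition distr_fun :: "(real ^ 'm) set \<Rightarrow> (real ^ 'm \<Rightarrow> real) \<Rightarrow> real \<Rightarrow> real" where
  "distr_fun D \<omega> t = measure lebesgue {x \<in> D. \<omega> x \<le> t} / measure lebesgue D"

definition monotone_rearr :: "(real ^ 'm) set \<Rightarrow> (real ^ 'm \<Rightarrow> real) \<Rightarrow> real \<Rightarrow> real" where
  "monotone_rearr D \<omega> x =
     Inf {t \<in> {Inf (ess_range D \<omega>)..Sup (ess_range D \<omega>)}. distr_fun D \<omega> t \<ge> x}"

text \<open>
  The inverse of a strictly increasing function on \<open>[0,1]\<close>, extended to be constant on the gaps of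
  its range: all \<open>t\<close> lying in the same gap have the same set \<open>{x \<in> [0,1]. f x \<le> t}\<close>, and the
  supremum of this set is the point where \<open>f\<close> jumps over the gap.
\<close>

definition gap_inverse :: "(real \<Rightarrow> real) \<Rightarrow> real \<Rightarrow> real" where
  "gap_inverse f t =
     (if t \<in> f ` {0..1} then the_inv_into {0..1} f t else Sup {x \<in> {0..1}. f x \<le> t})"

text \<open>
  The pieces are open intervals, so that the one-sided limits at a break point may differ from each
  other and from the value there.
\<close>

definition piecewise_lipschitz_on :: "real \<Rightarrow> real \<Rightarrow> (real \<Rightarrow> real) \<Rightarrow> bool" where
  "piecewise_lipschitz_on a b f \<longleftrightarrow>
     (\<exists>(N::nat) p. p 0 = a \<and> p N = b \<and>
        (\<forall>i<N. p i < p (Suc i) \<and> (\<exists>L. L-lipschitz_on {p i<..<p (Suc i)} f)))"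

end

theory Submission
  imports Defs "HOL-Probability.Distribution_Functions"
begin

text \<open>
  Let \<open>\<phi>\<close> be the distribution function of \<open>\<omega>\<close>, and let \<open>m\<close> and \<open>M\<close> be the extreme points of the
  essential range. The rearrangement of \<open>\<omega>\<close> is the quantile function \<open>q\<close> of \<open>\<phi>\<close>. Everything about
  it follows from the Galois connection \<open>q x \<le> t \<longleftrightarrow> x \<le> \<phi> t\<close> (lemma \<open>q_le_iff\<close>), which rests on the
  right-continuity of \<open>\<phi>\<close>. It identifies the generalised inverse of \<open>q\<close> with \<open>\<phi>\<close> on \<open>[m, M]\<close>
  (lemma \<open>gap_inverse_q\<close>). It also shows that a jump of \<open>\<phi>\<close> would be a flat piece of \<open>q\<close>; as \<open>q\<close> is
  strictly increasing, \<open>\<phi>\<close> has no jumps on \<open>[m, M]\<close> (lemma \<open>left_cont\<close>).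

  The spectral symbol says that the empirical eigenvalue distributions converge vaguely to the law of
  \<open>\<omega>\<close>. This law is carried by the compact set \<open>[m, M]\<close> and both sides have total mass one, so no mass
  can escape to infinity. Hence, as in the portmanteau theorem, the fraction of eigenvalues below a
  continuity point \<open>t\<close> of \<open>\<phi>\<close> tends to \<open>\<phi> t\<close> (lemma \<open>count_le_tendsto_cdf\<close>). This proves the first
  claim.

  For the second claim, comparing \<open>k n\<close> with the number of eigenvalues below a threshold \<open>s\<close> turns
  \<open>k n / n \<longlonglongrightarrow> x\<close> into inequalities between \<open>s\<close> and the \<open>k n\<close>-th eigenvalue. Thresholds below
  \<open>q x\<close> are always beaten in the end; thresholds above \<open>q x\<close> require that \<open>q\<close> does not jump at \<open>x\<close>
  (lemma \<open>order_statistic_tendsto\<close>). The essential range is closed, and a strictly increasing quantile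
  function with closed range is continuous (lemma \<open>continuous_q_of_closed_range\<close>), so both
  alternatives in the hypothesis amount to continuity at \<open>x\<close>.
\<close>

section \<open>Quantile functions\<close>

locale quantile =
  fixes \<phi> :: "real \<Rightarrow> real" and m M :: real
  assumes mono: "s \<le> t \<Longrightarrow> \<phi> s \<le> \<phi> t"
    and right_cont: "\<phi> t < c \<Longrightarrow> \<exists>s>t. \<phi> s < c"
    and nonneg: "0 \<le> \<phi> t"
    and le_one: "\<phi> t \<le> 1"
    and top: "\<phi> M = 1"
    and m_le_M: "m \<le> M"
begin

definition q :: "real \<Rightarrow> real" where
  "q x = Inf {t \<in> {m..M}. \<phi> t \<ge> x}"

lemma q_range: "x \<le> 1 \<Longrightarrow> q x \<in> {m..M}"
proof -
  assume x: "x \<le> 1"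
  have M: "M \<in> {t \<in> {m..M}. \<phi> t \<ge> x}" using top m_le_M x by auto
  have "bdd_below {t \<in> {m..M}. \<phi> t \<ge> x}" by (rule bdd_belowI[of _ m]) auto
  then have "q x \<le> M" unfolding q_def using M by (rule cInf_lower[rotated])
  moreover have "m \<le> q x" unfolding q_def using M by (intro cInf_greatest) auto
  ultimately show ?thesis by simp
qed

text \<open>
  As \<open>\<phi>\<close> is monotone, \<open>{t. x \<le> \<phi> t}\<close> is upward closed; right-continuity makes it contain its
  infimum, so that the infimum defining \<open>q x\<close> is attained.
\<close>

lemma q_le_iff:
  assumes "x \<le> 1" "t \<in> {m..M}"
  shows "q x \<le> t \<longleftrightarrow> x \<le> \<phi> t"
proof
  assume "x \<le> \<phi> t"
  moreover have "bdd_below {t \<in> {m..M}. \<phi> t \<ge> x}" by (rule bdd_belowI[of _ m]) auto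
  ultimately show "q x \<le> t" unfolding q_def using assms by (intro cInf_lower) auto
next
  assume le: "q x \<le> t"
  show "x \<le> \<phi> t"
  proof (rule ccontr)
    assume "\<not> x \<le> \<phi> t"
    then obtain s where s: "s > t" "\<phi> s < x" using right_cont[of t x] by auto
    have "s \<le> u" if "u \<in> {t \<in> {m..M}. \<phi> t \<ge> x}" for u
      using that s(2) mono[of u s] by fastforce
    moreover have "M \<in> {t \<in> {m..M}. \<phi> t \<ge> x}" using top m_le_M assms by auto
    ultimately have "s \<le> q x" unfolding q_def by (intro cInf_greatest) auto
    with s le show False by simp
  qed
qed

lemma less_q_iff: "x \<le> 1 \<Longrightarrow> t \<in> {m..M} \<Longrightarrow> t < q x \<longleftrightarrow> \<phi> t < x"
  using q_le_iff[of x t] by auto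

lemma q_mono: "x \<le> y \<Longrightarrow> y \<le> 1 \<Longrightarrow> q x \<le> q y"
  using q_le_iff[of y "q y"] q_le_iff[of x "q y"] q_range[of y] by auto

lemma le_\<phi>_q: "x \<le> 1 \<Longrightarrow> x \<le> \<phi> (q x)"
  using q_le_iff[of x "q x"] q_range[of x] by auto

text \<open>
  By the Galois connection the set whose supremum is taken on a gap is the interval \<open>[0, \<phi> t]\<close>. For
  \<open>t = q x\<close> strictness makes the same set \<open>[0, x]\<close>, so both branches of the definition give \<open>\<phi> t\<close>.
\<close>

lemma gap_inverse_q:
  assumes strict: "strict_mono_on {0..1} q" and t: "t \<in> {m..M}"
  shows "gap_inverse q t = \<phi> t"
proof -
  have set: "{x \<in> {0..1}. q x \<le> t} = {0..\<phi> t}"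
    using q_le_iff[OF _ t] le_one[of t] by (auto intro: order_trans)
  show ?thesis
  proof (cases "t \<in> q ` {0..1}")
    case True
    then obtain x where x: "x \<in> {0..1}" "t = q x" by auto
    have "q y \<le> t \<longleftrightarrow> y \<le> x" if "y \<in> {0..1}" for y
      unfolding x(2) using strict_mono_on_leD[OF strict that x(1)] strict_mono_onD[OF strict x(1) that]
      by (auto simp: not_less[symmetric])
    then have "{y \<in> {0..1}. q y \<le> t} = {0..x}" using x(1) by auto
    then have "x = \<phi> t" using set nonneg[of t] x by auto
    moreover have "the_inv_into {0..1} q t = x"
      using x strict_mono_on_imp_inj_on[OF strict] by (auto intro: the_inv_into_f_f)
    ultimately show ?thesis using True by (simp add: gap_inverse_def)
  next
    case False
    then show ?thesis using set nonneg[of t] by (simp add: gap_inverse_def)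
  qed
qed

text \<open>
  If \<open>\<phi>\<close> jumped at \<open>t\<close>, then \<open>q\<close> would take the value \<open>t\<close> on the whole range of heights skipped by
  the jump. Strictness excludes this: for heights \<open>y < y1 < y2\<close> below \<open>\<phi> t\<close> it gives
  \<open>q y1 < q y2 \<le> t\<close>, and \<open>\<phi>\<close> exceeds \<open>y\<close> at \<open>q y1\<close>. This form of left-continuity is what the portmanteau argument uses.
\<close>

lemma left_cont:
  assumes strict: "strict_mono_on {0..1} q" and t: "t \<in> {m..M}" and y: "y < \<phi> t"
  shows "\<exists>s<t. y < \<phi> s"
proof -
  \<comment> \<open>The function \<open>q\<close> is strictly increasing on \<open>[0, 1]\<close> only, so negative heights are raised to 0.\<close>
  define z where "z = max y 0"
  show ?thesis
  proof (cases "\<phi> t = 0")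
    case True
    then show ?thesis using y nonneg[of "t - 1"] by (intro exI[of _ "t - 1"]) auto
  next
    case False
    then have "z < \<phi> t" using y nonneg[of t] by (auto simp: z_def)
    then obtain y1 y2 where y12: "z < y1" "y1 < y2" "y2 < \<phi> t" by (meson dense)
    have b: "y1 \<in> {0..1}" "y2 \<in> {0..1}" using y12 le_one[of t] by (auto simp: z_def)
    have "q y1 < q y2" using strict_mono_onD[OF strict b] y12 by simp
    also have "\<dots> \<le> t" using q_le_iff[of y2 t] b t y12 by auto
    finally have "q y1 < t" .
    moreover have "y < \<phi> (q y1)" using le_\<phi>_q[of y1] b y12 by (auto simp: z_def)
    ultimately show ?thesis by blast
  qed
qed

lemma \<phi>_q:
  assumes strict: "strict_mono_on {0..1} q" and x: "x \<in> {0..1}"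
  shows "\<phi> (q x) = x"
  using gap_inverse_q[OF strict q_range[of x]] x strict_mono_on_imp_inj_on[OF strict]
  by (auto simp: gap_inverse_def the_inv_into_f_f)

text \<open>
  Quantile functions are left-continuous, again by the Galois connection. A jump to the right of \<open>x\<close>
  would put the right limit of \<open>q\<close> at \<open>x\<close> into the closed range, as some \<open>q z\<close> with \<open>z > x\<close>; but then
  the values of \<open>q\<close> between \<open>x\<close> and \<open>z\<close> lie strictly below that limit, which is their infimum.
\<close>

lemma continuous_q_of_closed_range:
  assumes strict: "strict_mono_on {0..1} q" and cl: "closed (q ` {0..1})" and x: "x \<in> {0..1}"
  shows "continuous (at x within {0..1}) q"
  unfolding continuous_within
proof (rule order_tendstoI)
  fix s assume s: "s < q x"
  show "\<forall>\<^sub>F y in at x within {0..1}. s < q y"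
  proof (cases "s < m")
    case True
    then have "s < q y" if "y \<in> {0..1}" for y using q_range[of y] that by auto
    then show ?thesis by (simp add: eventually_at_filter)
  next
    case False
    then have sm: "s \<in> {m..M}" using q_range[of x] s x by auto
    then have "\<phi> s < x" using s less_q_iff[of x s] x by auto
    then have "\<forall>\<^sub>F y in at x within {0..1}. \<phi> s < y"
      by (intro order_tendstoD(1)[OF tendsto_ident_at])
    moreover have "\<forall>\<^sub>F y in at x within {0..1}. y \<in> {0..1}"
      by (simp add: eventually_at_filter)
    ultimately show ?thesis
      by eventually_elim (use sm in \<open>auto simp: less_q_iff\<close>)
  qed
next
  fix s assume s: "q x < s"
  have "\<exists>y. y > x \<and> (\<forall>z\<in>{0..1}. z < y \<longrightarrow> q z < s)"
  proof (cases "x = 1")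
    case True
    then have "q z < s" if "z \<in> {0..1}" for z using s q_mono[of z 1] that by auto
    then show ?thesis using True by (intro exI[of _ 2]) auto
  next
    case False
    \<comment> \<open>The infimum of \<open>A\<close> is the right limit of \<open>q\<close> at \<open>x\<close>.\<close>
    define A where "A = q ` {x<..1}"
    have ne: "A \<noteq> {}" using False x by (auto simp: A_def)
    have bb: "bdd_below A" unfolding A_def using q_range by (intro bdd_belowI[of _ m]) auto
    have "Inf A \<in> closure A" using ne bb by (rule closure_contains_Inf)
    also have "closure A \<subseteq> q ` {0..1}"
      using x by (intro closure_minimal cl) (auto simp: A_def)
    finally obtain z where z: "z \<in> {0..1}" "Inf A = q z" by auto
    have "\<not> x < z"
    proof
      assume "x < z"
      then obtain w where w: "x < w" "w < z" by (meson dense)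
      then have "Inf A \<le> q w" using bb z x by (intro cInf_lower) (auto simp: A_def)
      moreover have "q w < q z" using strict_mono_onD[OF strict] w z x by auto
      ultimately show False using z by simp
    qed
    then have "Inf A < s" using z s q_mono[of z x] x by auto
    then obtain y where y: "x < y" "y \<le> 1" "q y < s"
      using ne cInf_lessD[of A s] by (auto simp: A_def)
    then have "q z < s" if "z < y" for z using q_mono[of z y] that by auto
    then show ?thesis using y(1) by blast
  qed
  then obtain y where y: "y > x" "\<And>z. z \<in> {0..1} \<Longrightarrow> z < y \<Longrightarrow> q z < s" by blast
  have "\<forall>\<^sub>F z in at x within {0..1}. z < y"
    using y(1) by (intro order_tendstoD(2)[OF tendsto_ident_at])
  moreover have "\<forall>\<^sub>F y in at x within {0..1}. y \<in> {0..1}"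
    by (simp add: eventually_at_filter)
  ultimately show "\<forall>\<^sub>F z in at x within {0..1}. q z < s"
    by eventually_elim (use y(2) in auto)
qed

end

section \<open>Order statistics\<close>

lemma card_le_order_statistic:
  fixes a :: "nat \<Rightarrow> real"
  assumes "mono_on {1..n} a" "k \<in> {1..n}" "a k \<le> t"
  shows "k \<le> card {j \<in> {1..n}. a j \<le> t}"
proof -
  have "{1..k} \<subseteq> {j \<in> {1..n}. a j \<le> t}"
  proof
    fix j assume "j \<in> {1..k}"
    then have "j \<in> {1..n}" "a j \<le> a k" using assms(2) mono_onD[OF assms(1), of j k] by auto
    then show "j \<in> {j \<in> {1..n}. a j \<le> t}" using assms(3) by auto
  qed
  then have "card {1..k} \<le> card {j \<in> {1..n}. a j \<le> t}" by (intro card_mono) auto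
  then show ?thesis by simp
qed

lemma card_less_order_statistic:
  fixes a :: "nat \<Rightarrow> real"
  assumes "mono_on {1..n} a" "k \<in> {1..n}" "t < a k"
  shows "card {j \<in> {1..n}. a j \<le> t} < k"
proof -
  have "{j \<in> {1..n}. a j \<le> t} \<subseteq> {1..<k}"
  proof
    fix j assume j: "j \<in> {j \<in> {1..n}. a j \<le> t}"
    then have "\<not> k \<le> j" using assms mono_onD[of "{1..n}" a k j] by fastforce
    with j show "j \<in> {1..<k}" by auto
  qed
  then have "card {j \<in> {1..n}. a j \<le> t} \<le> card {1..<k}" by (intro card_mono) auto
  then show ?thesis using assms(2) by auto
qed

context quantile
begin

text \<open>
  The condition \<open>q 1 = M\<close> serves the endpoint \<open>x = 1\<close>: there is no \<open>y > x\<close> at which \<open>q\<close> could bound the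
  order statistics from above, and only the bound \<open>M\<close> remains.
\<close>

lemma order_statistic_tendsto:
  fixes a :: "nat \<Rightarrow> nat \<Rightarrow> real" and k :: "nat \<Rightarrow> nat"
  assumes strict: "strict_mono_on {0..1} q" and q1: "q 1 = M"
    and a: "\<And>n. mono_on {1..n} (a n)"
    and lim: "\<And>t. t \<in> {m..M} \<Longrightarrow>
                (\<lambda>n. real (card {j \<in> {1..n}. a n j \<le> t}) / real n) \<longlonglongrightarrow> \<phi> t"
    and k: "\<forall>\<^sub>F n in sequentially. k n \<in> {1..n}"
    and kx: "(\<lambda>n. real (k n) / real n) \<longlonglongrightarrow> x"
    and bounds: "\<forall>\<^sub>F n in sequentially. a n (k n) \<in> {m..M}"
    and x: "x \<in> {0..1}" and cont: "continuous (at x within {0..1}) q"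
  shows "(\<lambda>n. a n (k n)) \<longlonglongrightarrow> q x"
proof (rule order_tendstoI)
  fix s assume s: "s < q x"
  show "\<forall>\<^sub>F n in sequentially. s < a n (k n)"
  proof (cases "s < m")
    case True
    from bounds show ?thesis by eventually_elim (use True in auto)
  next
    case False
    then have sm: "s \<in> {m..M}" using q_range[of x] s x by auto
    then have "\<phi> s < x" using s less_q_iff[of x s] x by auto
    then obtain c where c: "\<phi> s < c" "c < x" by (meson dense)
    have "\<forall>\<^sub>F n in sequentially. real (card {j \<in> {1..n}. a n j \<le> s}) / real n < c"
      using order_tendstoD(2)[OF lim[OF sm] c(1)] .
    moreover have "\<forall>\<^sub>F n in sequentially. c < real (k n) / real n"
      using order_tendstoD(1)[OF kx c(2)] .
    ultimately show ?thesis using k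
    proof eventually_elim
      case (elim n)
      then have "real (card {j \<in> {1..n}. a n j \<le> s}) / real n < real (k n) / real n" by simp
      then have "card {j \<in> {1..n}. a n j \<le> s} < k n"
        using elim(3) by (simp add: divide_less_cancel)
      then show ?case using card_le_order_statistic[OF a elim(3), of s] by force
    qed
  qed
next
  fix s assume s: "q x < s"
  show "\<forall>\<^sub>F n in sequentially. a n (k n) < s"
  proof (cases "x = 1")
    case True
    from bounds show ?thesis by eventually_elim (use True q1 s in auto)
  next
    case False
    have "\<forall>\<^sub>F y in at x within {0..1}. q y < s"
      using cont s by (auto simp: continuous_within intro: order_tendstoD(2))
    then obtain d where d: "d > 0"
      "\<And>y. y \<in> {0..1} \<Longrightarrow> y \<noteq> x \<Longrightarrow> dist y x < d \<Longrightarrow> q y < s"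
      unfolding eventually_at by blast
    define y where "y = min 1 (x + d / 2)"
    have y: "x < y" "y \<in> {0..1}" using d(1) x False by (auto simp: y_def)
    have qy: "q y < s" using d y by (auto intro!: d(2) simp: y_def dist_real_def)
    obtain c where c: "x < c" "c < y" using dense[OF y(1)] by blast
    have qm: "q y \<in> {m..M}" using y q_range by auto
    have "\<phi> (q y) = y" by (rule \<phi>_q[OF strict y(2)])
    then have "\<forall>\<^sub>F n in sequentially. c < real (card {j \<in> {1..n}. a n j \<le> q y}) / real n"
      using order_tendstoD(1)[OF lim[OF qm]] c by auto
    moreover have "\<forall>\<^sub>F n in sequentially. real (k n) / real n < c"
      using order_tendstoD(2)[OF kx c(1)] .
    ultimately show ?thesis using k
    proof eventually_elim
      case (elim n)
      then have "real (k n) / real n < real (card {j \<in> {1..n}. a n j \<le> q y}) / real n" by simp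
      then have "k n < card {j \<in> {1..n}. a n j \<le> q y}"
        using elim(3) by (simp add: divide_less_cancel)
      then show ?case using card_less_order_statistic[OF a elim(3), of "q y"] qy by force
    qed
  qed
qed

end

section \<open>Counting points under vague convergence\<close>

text \<open>
  A radial plateau in the plane: it is 1 on the disc of radius \<open>r\<close> about the real number \<open>c\<close> and
  falls linearly to 0 within a further distance \<open>\<delta>\<close>. It is radial in the plane because test functions
  live on the complex numbers; on the real line it is a trapezoid over the interval with midpoint \<open>c\<close>
  and half-length \<open>r\<close>.
\<close>

definition tent :: "real \<Rightarrow> real \<Rightarrow> real \<Rightarrow> complex \<Rightarrow> real" where
  "tent c r \<delta> z = max 0 (min 1 ((r + \<delta> - dist z (complex_of_real c)) / \<delta>))"

lemma tent_bounds: "0 \<le> tent c r \<delta> z" "tent c r \<delta> z \<le> 1"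
  by (auto simp: tent_def)

lemma tent_eq_1: "\<delta> > 0 \<Longrightarrow> dist z (of_real c) \<le> r \<Longrightarrow> tent c r \<delta> z = 1"
proof -
  assume d: "\<delta> > 0" and z: "dist z (of_real c) \<le> r"
  then have "1 \<le> (r + \<delta> - dist z (of_real c)) / \<delta>" by (subst le_divide_eq_1_pos) simp_all
  then show ?thesis unfolding tent_def by linarith
qed

lemma tent_eq_0: "\<delta> > 0 \<Longrightarrow> r + \<delta> \<le> dist z (of_real c) \<Longrightarrow> tent c r \<delta> z = 0"
proof -
  assume d: "\<delta> > 0" and z: "r + \<delta> \<le> dist z (of_real c)"
  then have "(r + \<delta> - dist z (of_real c)) / \<delta> \<le> 0" by (intro divide_nonpos_pos) simp_all
  then show ?thesis unfolding tent_def by linarith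
qed

lemma tent_Cc:
  assumes "\<delta> > 0"
  shows "(\<lambda>z. complex_of_real (tent c r \<delta> z)) \<in> Cc"
proof -
  have "{z. complex_of_real (tent c r \<delta> z) \<noteq> 0} \<subseteq> cball (of_real c) (r + \<delta>)"
    using tent_eq_0[OF assms, of r _ c] by (force simp: dist_commute)
  then have "bounded {z. complex_of_real (tent c r \<delta> z) \<noteq> 0}"
    by (rule bounded_subset[OF bounded_cball])
  then have "compact (closure {z. complex_of_real (tent c r \<delta> z) \<noteq> 0})" by simp
  moreover have "continuous_on UNIV (\<lambda>z. complex_of_real (tent c r \<delta> z))"
    unfolding tent_def using assms by (intro continuous_intros) auto
  ultimately show ?thesis by (simp add: Cc_def)
qed

lemma dist_of_real_midpoint:
  fixes a b y :: real
  shows "dist (complex_of_real y) (of_real ((a + b) / 2)) = \<bar>y - (a + b) / 2\<bar>"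
  by (simp only: dist_of_real dist_real_def)

text \<open>
  Vague convergence of the empirical measures of the rows of \<open>a\<close> to the normalised measure \<open>\<mu>\<close>, with
  the test functions of the spectral symbol, that is, defined on the complex plane.
\<close>

definition vague_limit :: "(nat \<Rightarrow> nat \<Rightarrow> real) \<Rightarrow> real measure \<Rightarrow> bool" where
  "vague_limit a \<mu> \<longleftrightarrow>
     (\<forall>F\<in>Cc. (\<lambda>n. (\<Sum>k\<in>{1..n}. F (of_real (a n k))) / of_nat n)
        \<longlonglongrightarrow> (\<integral>y. F (of_real y) \<partial>\<mu>) / of_real (measure \<mu> UNIV))"

context finite_borel_measure
begin

text \<open>
  The portmanteau lower bound: a plateau that equals 1 on the closed interval and vanishes outside
  the larger open one is dominated by the count on the left and dominates the measure on the right.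
\<close>

lemma eventually_count_gt:
  assumes lim: "vague_limit a M"
    and ab: "a' < l" "l \<le> u" "u < b'"
    and c: "c < measure M {l..u} / measure M UNIV"
  shows "\<forall>\<^sub>F n in sequentially. c < real (card {k \<in> {1..n}. a' < a n k \<and> a n k < b'}) / real n"
proof -
  \<comment> \<open>The slopes have to fit into the shorter of the two margins.\<close>
  define \<delta> where "\<delta> = min (l - a') (b' - u)"
  define F where "F = tent ((l + u) / 2) ((u - l) / 2) \<delta>"
  have d: "\<delta> > 0" using ab by (auto simp: \<delta>_def)
  have F1: "F (of_real y) = 1" if "y \<in> {l..u}" for y
    unfolding F_def
  proof (intro tent_eq_1 d)
    show "dist (complex_of_real y) (complex_of_real ((l + u) / 2)) \<le> (u - l) / 2"
      using that unfolding dist_of_real_midpoint by (auto simp: abs_le_iff field_simps)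
  qed
  have F0: "F (of_real y) = 0" if "\<not> (a' < y \<and> y < b')" for y
    unfolding F_def
  proof (intro tent_eq_0 d)
    show "(u - l) / 2 + \<delta> \<le> dist (complex_of_real y) (complex_of_real ((l + u) / 2))"
      using that ab unfolding dist_of_real_midpoint \<delta>_def by (auto simp: abs_if field_simps min_def)
  qed
  have Fb: "0 \<le> F z" "F z \<le> 1" for z unfolding F_def by (rule tent_bounds)+
  have FCc: "(\<lambda>z. complex_of_real (F z)) \<in> Cc" unfolding F_def by (rule tent_Cc[OF d])
  have "continuous_on UNIV (\<lambda>y. F (complex_of_real y))"
    unfolding F_def tent_def using d by (intro continuous_intros) auto
  then have Fm: "(\<lambda>y. F (complex_of_real y)) \<in> borel_measurable M"
    unfolding measurable_cong_sets[OF M_is_borel refl] by (rule borel_measurable_continuous_onI)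
  have Fi: "integrable M (\<lambda>y. F (complex_of_real y))"
    by (rule integrable_const_bound[where B = 1]) (use Fb Fm in auto)
  have "measure M {l..u} = (\<integral>y. indicator {l..u} y \<partial>M)"
    by (simp add: sets_eq_imp_space_eq[OF M_is_borel])
  also have "\<dots> \<le> (\<integral>y. F (complex_of_real y) \<partial>M)"
  proof (rule integral_mono[OF _ Fi])
    show "integrable M (indicator {l..u} :: real \<Rightarrow> real)"
      by (rule integrable_real_indicator) (auto simp: less_top[symmetric])
    show "indicator {l..u} y \<le> F (complex_of_real y)" for y
      using Fb F1 by (simp add: indicator_def)
  qed
  finally have "measure M {l..u} / measure M UNIV \<le> (\<integral>y. F (complex_of_real y) \<partial>M) / measure M UNIV"
    by (intro divide_right_mono) auto
  with c have c': "c < (\<integral>y. F (complex_of_real y) \<partial>M) / measure M UNIV" by simp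
  have "(\<lambda>n. (\<Sum>k\<in>{1..n}. complex_of_real (F (of_real (a n k)))) / of_nat n)
     \<longlonglongrightarrow> (\<integral>y. complex_of_real (F (of_real y)) \<partial>M) / of_real (measure M UNIV)"
    by (rule bspec[OF lim[unfolded vague_limit_def] FCc])
  then have "(\<lambda>n. complex_of_real ((\<Sum>k\<in>{1..n}. F (of_real (a n k))) / real n))
     \<longlonglongrightarrow> complex_of_real ((\<integral>y. F (of_real y) \<partial>M) / measure M UNIV)"
    by simp
  then have "(\<lambda>n. (\<Sum>k\<in>{1..n}. F (of_real (a n k))) / real n)
     \<longlonglongrightarrow> (\<integral>y. F (of_real y) \<partial>M) / measure M UNIV"
    by (simp only: tendsto_of_real_iff)
  from order_tendstoD(1)[OF this c'] show ?thesis
  proof eventually_elim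
    case (elim n)
    have "(\<Sum>k\<in>{1..n}. F (of_real (a n k)))
        \<le> (\<Sum>k\<in>{1..n}. if a' < a n k \<and> a n k < b' then 1 else 0)"
      by (rule sum_mono) (use Fb F0 in auto)
    also have "\<dots> = real (card {k \<in> {1..n}. a' < a n k \<and> a n k < b'})"
      by (simp add: sum.If_cases Int_def)
    finally have "(\<Sum>k\<in>{1..n}. F (of_real (a n k))) / real n
      \<le> real (card {k \<in> {1..n}. a' < a n k \<and> a n k < b'}) / real n"
      by (rule divide_right_mono) simp
    with elim show ?case by simp
  qed
qed

text \<open>
  A lower bound on \<open>(-\<infinity>, t]\<close> comes from a compact interval just below \<open>t\<close> that carries nearly all the
  mass there. The upper bound is the same lower bound applied to a compact interval just above \<open>t\<close>:
  the points in it are missing from the count of those below \<open>t\<close>. The bounded support provides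
  the compact intervals.
\<close>

lemma count_le_tendsto_cdf:
  assumes lim: "vague_limit a M" and pos: "measure M UNIV > 0"
    and supp: "AE y in M. y \<in> {lo..hi}"
    and left: "\<And>c. c < cdf M t / measure M UNIV \<Longrightarrow> \<exists>s<t. c < cdf M s / measure M UNIV"
    and right: "\<And>c. cdf M t / measure M UNIV < c \<Longrightarrow> \<exists>s>t. cdf M s / measure M UNIV < c"
  shows "(\<lambda>n. real (card {k \<in> {1..n}. a n k \<le> t}) / real n) \<longlonglongrightarrow> cdf M t / measure M UNIV"
proof (rule order_tendstoI)
  fix c assume "c < cdf M t / measure M UNIV"
  then obtain s where s: "s < t" "c < cdf M s / measure M UNIV" using left by blast
  define l where "l = min lo s"
  have "cdf M s = measure M {l..s}"
    unfolding cdf_def l_def by (rule finite_measure_eq_AE) (use supp in auto)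
  then have "\<forall>\<^sub>F n in sequentially. c < real (card {k \<in> {1..n}. l - 1 < a n k \<and> a n k < t}) / real n"
    using s by (intro eventually_count_gt[OF lim, of _ l s]) (auto simp: l_def)
  then show "\<forall>\<^sub>F n in sequentially. c < real (card {k \<in> {1..n}. a n k \<le> t}) / real n"
  proof eventually_elim
    case (elim n)
    have "real (card {k \<in> {1..n}. l - 1 < a n k \<and> a n k < t}) / real n
       \<le> real (card {k \<in> {1..n}. a n k \<le> t}) / real n"
      by (intro divide_right_mono) (auto intro!: card_mono)
    with elim show ?case by simp
  qed
next
  fix c assume "cdf M t / measure M UNIV < c"
  then obtain s where s: "t < s" "cdf M s / measure M UNIV < c" using right by blast
  define u where "u = max hi s"
  have "measure M UNIV \<le> measure M ({..s} \<union> {s..u})"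
    by (rule finite_measure_mono_AE) (use supp in \<open>auto simp: u_def\<close>)
  also have "\<dots> \<le> cdf M s + measure M {s..u}"
    unfolding cdf_def by (rule measure_Un_le) auto
  finally have "1 - c < measure M {s..u} / measure M UNIV"
    using s(2) pos by (simp add: field_simps)
  then have "\<forall>\<^sub>F n in sequentially. 1 - c < real (card {k \<in> {1..n}. t < a n k \<and> a n k < u + 1}) / real n"
    using s by (intro eventually_count_gt[OF lim, of _ s u]) (auto simp: u_def)
  then show "\<forall>\<^sub>F n in sequentially. real (card {k \<in> {1..n}. a n k \<le> t}) / real n < c"
    using eventually_gt_at_top[of 0]
  proof eventually_elim
    case (elim n)
    have "card {k \<in> {1..n}. a n k \<le> t} + card {k \<in> {1..n}. t < a n k \<and> a n k < u + 1}
        = card ({k \<in> {1..n}. a n k \<le> t} \<union> {k \<in> {1..n}. t < a n k \<and> a n k < u + 1})"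
      by (rule card_Un_disjoint[symmetric]) auto
    also have "\<dots> \<le> card {1..n}" by (rule card_mono) auto
    finally have "real (card {k \<in> {1..n}. a n k \<le> t})
       + real (card {k \<in> {1..n}. t < a n k \<and> a n k < u + 1}) \<le> real n" by simp
    with elim show ?case by (simp add: field_simps)
  qed
qed

end

section \<open>The distribution of the symbol\<close>

text \<open>
  The law of \<open>\<omega>\<close> is a finite Borel measure on the line of total mass \<open>measure lebesgue D\<close>. The essential
  range is its support, and the distribution function of \<open>\<omega>\<close> is its normalised cumulative
  distribution function.
\<close>

locale bounded_symbol =
  fixes D :: "(real ^ 'm) set" and \<omega> :: "real ^ 'm \<Rightarrow> real"
  assumes D: "D \<in> lmeasurable" and D_pos: "measure lebesgue D > 0"
    and \<omega>: "\<omega> \<in> borel_measurable (lebesgue_on D)"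
    and bounded: "bounded (ess_range D \<omega>)"
begin

definition law :: "real measure" where
  "law = distr (lebesgue_on D) borel \<omega>"

lemma measure_law:
  assumes "S \<in> sets borel"
  shows "measure law S = measure lebesgue {x \<in> D. \<omega> x \<in> S}"
proof -
  have "measure law S = measure (lebesgue_on D) (\<omega> -` S \<inter> space (lebesgue_on D))"
    unfolding law_def using \<omega> assms by (rule measure_distr)
  also have "\<dots> = measure lebesgue (\<omega> -` S \<inter> D)"
    using D by (simp add: measure_restrict_space)
  finally show ?thesis by (simp add: vimage_def Int_def conj_commute)
qed

lemma finite_measure_lebesgue_on: "finite_measure (lebesgue_on D)"
  using D by (intro finite_measureI)
    (auto simp: emeasure_restrict_space fmeasurable_def)

sublocale finite_borel_measure law
proof -
  interpret finite_measure "lebesgue_on D" by (rule finite_measure_lebesgue_on)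
  show "finite_borel_measure law"
    unfolding finite_borel_measure_def finite_borel_measure_axioms_def law_def
    using \<omega> by (auto intro: finite_measure_distr)
qed

lemma sets_law [simp]: "sets law = sets borel"
  by (simp add: law_def)

lemma measure_law_UNIV: "measure law UNIV = measure lebesgue D"
  by (simp add: measure_law)

lemma distr_fun_eq_cdf: "distr_fun D \<omega> t = cdf law t / measure law UNIV"
  by (simp add: distr_fun_def cdf_def measure_law)

lemma ess_range_eq: "ess_range D \<omega> = {t. \<forall>\<epsilon>>0. measure law (ball t \<epsilon>) > 0}"
  by (simp add: ess_range_def measure_law dist_real_def abs_minus_commute)

lemma null_ball_if_notin_ess_range:
  assumes "t \<notin> ess_range D \<omega>"
  obtains \<epsilon> where "\<epsilon> > 0" "measure law (ball t \<epsilon>) = 0"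
proof -
  obtain \<epsilon> where "\<epsilon> > 0" "\<not> measure law (ball t \<epsilon>) > 0"
    using assms by (auto simp: ess_range_eq)
  then show ?thesis using measure_nonneg[of law "ball t \<epsilon>"] by (intro that[of \<epsilon>]) simp_all
qed

lemma closed_ess_range: "closed (ess_range D \<omega>)"
  unfolding closed_def open_contains_ball
proof
  fix t assume "t \<in> - ess_range D \<omega>"
  then obtain \<epsilon> where e: "\<epsilon> > 0" "measure law (ball t \<epsilon>) = 0"
    using null_ball_if_notin_ess_range by auto
  have "s \<notin> ess_range D \<omega>" if s: "s \<in> ball t \<epsilon>" for s
  proof -
    obtain d where d: "d > 0" "ball s d \<subseteq> ball t \<epsilon>"
      using s open_ball[of t \<epsilon>] open_contains_ball by blast
    have "measure law (ball s d) \<le> measure law (ball t \<epsilon>)"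
      by (rule finite_measure_mono[OF d(2)]) simp
    then have "\<not> measure law (ball s d) > 0" using e(2) by simp
    then show ?thesis using d(1) by (auto simp: ess_range_eq)
  qed
  then show "\<exists>e>0. ball t e \<subseteq> - ess_range D \<omega>" using e(1) by blast
qed

text \<open>
  The complement of the support is covered by null balls, hence by countably many of them.
\<close>

lemma AE_ess_range: "AE y in law. y \<in> ess_range D \<omega>"
proof -
  define \<F> where "\<F> = {ball t \<epsilon> | t \<epsilon>. measure law (ball t \<epsilon>) = 0}"
  obtain \<F>' where F': "\<F>' \<subseteq> \<F>" "countable \<F>'" "\<Union>\<F>' = \<Union>\<F>"
    by (rule Lindelof[of \<F>]) (auto simp: \<F>_def)
  have "(\<Union>B\<in>\<F>'. B) \<in> null_sets law"
    using F'(1) by (intro null_sets_UN' F'(2)) (auto simp: \<F>_def null_sets_def emeasure_eq_measure)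
  then have "AE y in law. y \<notin> (\<Union>B\<in>\<F>'. B)" by (rule AE_not_in)
  then show ?thesis
  proof eventually_elim
    case (elim y)
    show ?case
    proof (rule ccontr)
      assume "y \<notin> ess_range D \<omega>"
      then obtain \<epsilon> where e: "\<epsilon> > 0" "measure law (ball y \<epsilon>) = 0"
        using null_ball_if_notin_ess_range by blast
      then have "y \<in> \<Union>\<F>" unfolding \<F>_def by (auto intro!: exI[of _ "ball y \<epsilon>"])
      then show False using elim F'(3) by auto
    qed
  qed
qed

lemma ess_range_nonempty: "ess_range D \<omega> \<noteq> {}"
proof
  assume "ess_range D \<omega> = {}"
  then have "AE y in law. y \<in> {}" using AE_ess_range by simp
  then have "measure law UNIV = measure law {}"
    by (intro finite_measure_eq_AE) auto
  then show False using D_pos measure_law_UNIV by simp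
qed

lemma ess_range_subset: "ess_range D \<omega> \<subseteq> {Inf (ess_range D \<omega>)..Sup (ess_range D \<omega>)}"
  using bounded_imp_bdd_below[OF bounded] bounded_imp_bdd_above[OF bounded]
  by (auto intro: cInf_lower cSup_upper)

text \<open>
  Below the supremum of the support some point of the support is still ahead, and a ball around it
  carries mass that \<open>distr_fun\<close> has not yet collected.
\<close>

lemma distr_fun_less_1:
  assumes "t < Sup (ess_range D \<omega>)"
  shows "distr_fun D \<omega> t < 1"
proof -
  obtain r where r: "r \<in> ess_range D \<omega>" "t < r"
    using assms less_cSup_iff[OF ess_range_nonempty] bounded_imp_bdd_above[OF bounded] by blast
  have "cdf law t + measure law (ball r (r - t)) = measure law ({..t} \<union> ball r (r - t))"
    unfolding cdf_def
    by (rule finite_measure_Union[symmetric]) (auto simp: dist_real_def)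
  also have "\<dots> \<le> measure law UNIV" by (rule finite_measure_mono) auto
  moreover have "measure law (ball r (r - t)) > 0"
    using r by (simp add: ess_range_eq)
  ultimately have "cdf law t < measure law UNIV" by linarith
  then show ?thesis using D_pos by (simp add: distr_fun_eq_cdf measure_law_UNIV)
qed

sublocale quantile "distr_fun D \<omega>" "Inf (ess_range D \<omega>)" "Sup (ess_range D \<omega>)"
proof
  have pos: "measure law UNIV > 0" using D_pos measure_law_UNIV by simp
  show "distr_fun D \<omega> s \<le> distr_fun D \<omega> t" if "s \<le> t" for s t
    unfolding distr_fun_eq_cdf using cdf_nondecreasing[OF that] by (intro divide_right_mono) auto
  show "\<exists>s>t. distr_fun D \<omega> s < c" if c: "distr_fun D \<omega> t < c" for t c
  proof -
    have "(cdf law \<longlongrightarrow> cdf law t) (at_right t)"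
      using cdf_is_right_cont by (simp add: continuous_within)
    then have "((\<lambda>s. distr_fun D \<omega> s) \<longlongrightarrow> distr_fun D \<omega> t) (at_right t)"
      unfolding distr_fun_eq_cdf using pos by (intro tendsto_intros) auto
    then have "\<forall>\<^sub>F s in at_right t. distr_fun D \<omega> s < c \<and> t < s"
      using c by (intro eventually_conj order_tendstoD(2)) (auto simp: eventually_at_right_less)
    from eventually_happens[OF this] show ?thesis by auto
  qed
  show "0 \<le> distr_fun D \<omega> t" for t by (simp add: distr_fun_def)
  show "distr_fun D \<omega> t \<le> 1" for t
    unfolding distr_fun_eq_cdf cdf_def using pos by (auto intro: finite_measure_mono)
  have "AE y in law. y \<in> {..Sup (ess_range D \<omega>)} \<longleftrightarrow> y \<in> UNIV"
    using AE_ess_range by eventually_elim (use ess_range_subset in auto)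
  then have "cdf law (Sup (ess_range D \<omega>)) = measure law UNIV"
    unfolding cdf_def by (intro finite_measure_eq_AE) auto
  then show "distr_fun D \<omega> (Sup (ess_range D \<omega>)) = 1"
    using pos by (simp add: distr_fun_eq_cdf)
  show "Inf (ess_range D \<omega>) \<le> Sup (ess_range D \<omega>)"
    using ess_range_nonempty ess_range_subset by fastforce
qed

lemma q_eq_monotone_rearr: "q = monotone_rearr D \<omega>"
  by (simp add: fun_eq_iff q_def monotone_rearr_def)

text \<open>
  At \<open>q 1\<close> all the mass has been collected, so \<open>q 1\<close> cannot lie below the top of the support.
\<close>

lemma q_1: "q 1 = Sup (ess_range D \<omega>)"
  using q_range[of 1] le_\<phi>_q[of 1] distr_fun_less_1[of "q 1"] by force

lemma count_le_tendsto_distr_fun: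
  assumes "vague_limit a law" "strict_mono_on {0..1} q"
    and t: "t \<in> {Inf (ess_range D \<omega>)..Sup (ess_range D \<omega>)}"
  shows "(\<lambda>n. real (card {k \<in> {1..n}. a n k \<le> t}) / real n) \<longlonglongrightarrow> distr_fun D \<omega> t"
  unfolding distr_fun_eq_cdf
proof (rule count_le_tendsto_cdf[OF assms(1)])
  show "measure law UNIV > 0" using D_pos measure_law_UNIV by simp
  show "AE y in law. y \<in> {Inf (ess_range D \<omega>)..Sup (ess_range D \<omega>)}"
    using AE_ess_range by eventually_elim (use ess_range_subset in blast)
  show "\<exists>s<t. c < cdf law s / measure law UNIV" if "c < cdf law t / measure law UNIV" for c
    using left_cont[OF assms(2) t, of c] that unfolding distr_fun_eq_cdf by blast
  show "\<exists>s>t. cdf law s / measure law UNIV < c" if "cdf law t / measure law UNIV < c" for c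
    using right_cont[of t c] that unfolding distr_fun_eq_cdf by blast
qed

end

section \<open>Eigenvalues\<close>

text \<open>
  A complex \<open>n \<times> n\<close> matrix has \<open>n\<close> eigenvalues with multiplicity, so for indices from 1 to \<open>n\<close> the
  list access in \<open>eigval\<close> is never out of bounds.
\<close>

lemma mset_eigval:
  assumes "A \<in> carrier_mat n n"
  shows "mset (map (eigval A) [1..<Suc n]) = image_mset Re (eigvals_mset A)"
    and "mono_on {1..n} (eigval A)"
proof -
  let ?xs = "sorted_list_of_multiset (image_mset Re (eigvals_mset A))"
  have len: "length ?xs = n"
  proof -
    have "length ?xs = size (mset ?xs)" by (simp only: size_mset)
    also have "\<dots> = size (proots (char_poly A))" by (simp add: eigvals_mset_def)
    also have "\<dots> = n" using degree_monic_char_poly[OF assms] by (simp add: size_proots_complex)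
    finally show ?thesis .
  qed
  have "map (eigval A) [1..<Suc n] = ?xs"
    by (rule nth_equalityI) (auto simp: len eigval_def simp del: upt_Suc)
  then show "mset (map (eigval A) [1..<Suc n]) = image_mset Re (eigvals_mset A)"
    by (simp only: mset_sorted_list_of_multiset)
  show "mono_on {1..n} (eigval A)"
    unfolding eigval_def by (intro mono_onI sorted_nth_mono) (auto simp: len)
qed

lemma sum_eigvals_mset:
  assumes A: "A \<in> carrier_mat n n" and real: "\<And>z. eigenvalue A z \<Longrightarrow> z \<in> \<real>"
  shows "(\<Sum>z\<in>#eigvals_mset A. F z) = (\<Sum>k\<in>{1..n}. F (complex_of_real (eigval A k)))"
proof -
  have "char_poly A \<noteq> 0"
    using degree_monic_char_poly[OF A] by auto
  then have "of_real (Re z) = z" if "z \<in># eigvals_mset A" for z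
    using that real[of z] eigenvalue_root_char_poly[OF A] by (auto simp: eigvals_mset_def)
  then have "(\<Sum>z\<in>#eigvals_mset A. F z) = (\<Sum>z\<in>#eigvals_mset A. F (of_real (Re z)))"
    by (intro arg_cong[where f = sum_mset] image_mset_cong) simp
  also have "\<dots> = (\<Sum>y\<in>#image_mset Re (eigvals_mset A). F (of_real y))"
    by (simp add: multiset.map_comp o_def)
  also have "\<dots> = (\<Sum>y\<leftarrow>map (eigval A) [1..<Suc n]. F (of_real y))"
    unfolding mset_eigval(1)[OF A, symmetric] mset_map[symmetric] sum_mset_sum_list ..
  also have "\<dots> = (\<Sum>k\<leftarrow>[1..<Suc n]. F (of_real (eigval A k)))"
    by (simp add: o_def del: upt_Suc)
  also have "\<dots> = (\<Sum>k\<in>{1..n}. F (of_real (eigval A k)))"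
    by (simp only: sum_list_distinct_conv_sum_set distinct_upt set_upt atLeastLessThanSuc_atLeastAtMost)
  finally show ?thesis .
qed

lemma (in bounded_symbol) vague_limit_eigval:
  assumes T: "\<And>n. n \<ge> 1 \<Longrightarrow> T n \<in> carrier_mat n n"
    and real: "\<And>n z. n \<ge> 1 \<Longrightarrow> eigenvalue (T n) z \<Longrightarrow> z \<in> \<real>"
    and symbol: "has_spectral_symbol T D (\<lambda>x. complex_of_real (\<omega> x))"
  shows "vague_limit (\<lambda>n. eigval (T n)) law"
  unfolding vague_limit_def
proof
  fix F assume F: "F \<in> Cc"
  then have "F \<in> borel_measurable borel"
    by (auto simp: Cc_def intro: borel_measurable_continuous_onI)
  then have "(\<lambda>y. F (complex_of_real y)) \<in> borel_measurable borel" by measurable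
  then have int: "(\<integral>y. F (of_real y) \<partial>law) = (\<integral>x. F (of_real (\<omega> x)) \<partial>lebesgue_on D)"
    unfolding law_def using \<omega> by (intro integral_distr)
  have "(\<lambda>n. (\<Sum>z\<in>#eigvals_mset (T n). F z) / of_nat n)
      \<longlonglongrightarrow> (\<integral>y. F (of_real y) \<partial>law) / of_real (measure law UNIV)"
    using symbol F unfolding has_spectral_symbol_def int measure_law_UNIV by blast
  moreover have "\<forall>\<^sub>F n in sequentially. (\<Sum>z\<in>#eigvals_mset (T n). F z) / of_nat n
      = (\<Sum>k\<in>{1..n}. F (of_real (eigval (T n) k))) / of_nat n"
    using eventually_ge_at_top[of 1]
    by eventually_elim (simp add: sum_eigvals_mset[OF T real])
  ultimately show "(\<lambda>n. (\<Sum>k\<in>{1..n}. F (of_real (eigval (T n) k))) / of_nat n)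
      \<longlonglongrightarrow> (\<integral>y. F (of_real y) \<partial>law) / of_real (measure law UNIV)"
    by (rule Lim_transform_eventually)
qed

theorem theorem3p4p1:
  fixes T :: "nat \<Rightarrow> complex mat"
    and D :: "(real ^ 'm) set"
    and \<omega> :: "real ^ 'm \<Rightarrow> real"
  assumes "\<And>n. n \<ge> 1 \<Longrightarrow> T n \<in> carrier_mat n n"
    and "\<And>n z. n \<ge> 1 \<Longrightarrow> eigenvalue (T n) z \<Longrightarrow> z \<in> \<real>"
    and "D \<in> lmeasurable" and "measure lebesgue D > 0"
    and "integrable (lebesgue_on D) \<omega>"
    and "has_spectral_symbol T D (\<lambda>x. complex_of_real (\<omega> x))"
    and "bounded (ess_range D \<omega>)"
    and "strict_mono_on {0..1} (monotone_rearr D \<omega>)"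
    and "piecewise_lipschitz_on 0 1 (monotone_rearr D \<omega>)"
  shows "(\<forall>t \<in> {Inf (ess_range D \<omega>)..Sup (ess_range D \<omega>)}.
            (\<lambda>n. real (card {k \<in> {1..n}. eigval (T n) k \<le> t}) / real n)
              \<longlonglongrightarrow> gap_inverse (monotone_rearr D \<omega>) t) \<and>
         (\<forall>(k :: nat \<Rightarrow> nat) x.
            x \<in> {0..1} \<longrightarrow>
            (\<forall>\<^sub>F n in sequentially. k n \<in> {1..n}) \<longrightarrow>
            (\<lambda>n. real (k n) / real n) \<longlonglongrightarrow> x \<longrightarrow>
            (\<forall>\<^sub>F n in sequentially. eigval (T n) (k n) \<in> ess_range D \<omega>) \<longrightarrow>
            (monotone_rearr D \<omega> ` {0..1} = ess_range D \<omega> \<or>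
              continuous (at x within {0..1}) (monotone_rearr D \<omega>)) \<longrightarrow>
            (\<lambda>n. eigval (T n) (k n) - monotone_rearr D \<omega> (real (k n) / real n)) \<longlonglongrightarrow> 0 \<and>
            (\<lambda>n. (real (k n) / real n, eigval (T n) (k n))) \<longlonglongrightarrow> (x, monotone_rearr D \<omega> x))"
proof -
  interpret bounded_symbol D \<omega>
    using assms(3-5,7) by unfold_locales auto
  let ?R = "{Inf (ess_range D \<omega>)..Sup (ess_range D \<omega>)}"
  have strict: "strict_mono_on {0..1} q" using assms(8) by (simp only: q_eq_monotone_rearr)
  have count: "(\<lambda>n. real (card {k \<in> {1..n}. eigval (T n) k \<le> t}) / real n) \<longlonglongrightarrow> distr_fun D \<omega> t"
    if "t \<in> ?R" for t
    using that by (intro count_le_tendsto_distr_fun[OF vague_limit_eigval strict]) (use assms in auto)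
  have sorted: "mono_on {1..n} (eigval (T n))" for n
    using mset_eigval(2)[OF assms(1)] by (cases "n = 0") (auto simp: mono_on_def)
  show ?thesis
    unfolding q_eq_monotone_rearr[symmetric]
  proof (intro conjI ballI allI impI)
    fix t assume "t \<in> ?R"
    then show "(\<lambda>n. real (card {k \<in> {1..n}. eigval (T n) k \<le> t}) / real n) \<longlonglongrightarrow> gap_inverse q t"
      using count gap_inverse_q[OF strict] by simp
  next
    fix k :: "nat \<Rightarrow> nat" and x :: real
    assume x: "x \<in> {0..1}" and k: "\<forall>\<^sub>F n in sequentially. k n \<in> {1..n}"
      and kx: "(\<lambda>n. real (k n) / real n) \<longlonglongrightarrow> x"
      and ran: "\<forall>\<^sub>F n in sequentially. eigval (T n) (k n) \<in> ess_range D \<omega>"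
      and alt: "q ` {0..1} = ess_range D \<omega> \<or> continuous (at x within {0..1}) q"
    have cont: "continuous (at x within {0..1}) q"
      using alt continuous_q_of_closed_range[OF strict _ x] closed_ess_range by auto
    have "\<forall>\<^sub>F n in sequentially. eigval (T n) (k n) \<in> ?R"
      using ran by eventually_elim (use ess_range_subset in blast)
    then have ev: "(\<lambda>n. eigval (T n) (k n)) \<longlonglongrightarrow> q x"
      by (intro order_statistic_tendsto[OF strict q_1 sorted count k kx _ x cont])
    have "\<forall>\<^sub>F n in sequentially. real (k n) / real n \<in> {0..1}"
      using k by eventually_elim auto
    then have "(\<lambda>n. q (real (k n) / real n)) \<longlonglongrightarrow> q x"
      using continuous_within_tendsto_compose[OF cont _ kx] by blast
    from tendsto_diff[OF ev this]
    show "(\<lambda>n. eigval (T n) (k n) - q (real (k n) / real n)) \<longlonglongrightarrow> 0" by simp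
    show "(\<lambda>n. (real (k n) / real n, eigval (T n) (k n))) \<longlonglongrightarrow> (x, q x)"
      using kx ev by (rule tendsto_Pair)
  qed
qed

end
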